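(* Let $X$ be a finite dimensional normed space, the functions $f$ and $\varphi$ be lower semicontinuous on $A$, and $A$ be closed. Then the penalty function $F_\lambda=f+\lambda\varphi$ is exact on any (nonempty) bounded set $C\subset A$ if and only if $F_\lambda$ is exact at every globally optimal solution of the problem $(\mathcal{P})$: $\min f(x)$ subject to $x\in M$, $x\in A$.
   Context: $M,A\subset X$ are nonempty, $f\colon X\to\mathbb{R}\cup\{+\infty\}$, $\varphi\colon X\to[0,+\infty)$ with $M=\{x\in X\mid\varphi(x)=0\}$, $\Omega=M\cap A$, $f^*=\inf_{x\in\Omega}f(x)$, $F_\lambda(x)=f(x)+\lambda\varphi(x)$ for $\lambda\ge0$. Standing assumptions: $f(x)<+\infty$ for some $x\in\Omega$, and $f$ attains a global minimum on $\Omega$. For a nonempty set $C\subset A$, $F_\lambda$ is exact on $C$ if there exists $\lambda^*\ge0$ (which may depend on $C$) such that for every $\lambda\ge\lambda^*$ one has $F_\lambda(x)\ge f^*$ for all $x\in C$. $F_\lambda$ is exact at a point $x^*$ (a locally, in particular globally, optimal solution of $(\mathcal{P})$) if there exists $\lambda^*\ge0$ such that $x^*$ is a point of local minimum of $F_{\lambda^*}$ on $A$. *)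

theory Defs
  imports "HOL-Analysis.Analysis"
begin

text \<open>
  Objective functions into the reals extended by plus infinity are rendered as
  \<open>ereal\<close>-valued functions that never take the value \<open>-\<infinity>\<close>.
\<close>

(* Lower semicontinuity of g as a function on the subspace A: only values of g on A matter.
   Deleting the point x from its neighbourhoods ("at x within A") is harmless, since y < g x. *)
definition lower_semicontinuous_on :: "'a::topological_space set \<Rightarrow> ('a \<Rightarrow> 'b::linorder) \<Rightarrow> bool"
  where "lower_semicontinuous_on A g \<longleftrightarrow>
    (\<forall>x\<in>A. \<forall>y<g x. \<forall>\<^sub>F z in at x within A. y < g z)"

definition local_minimum_on :: "('a::topological_space \<Rightarrow> 'b::linorder) \<Rightarrow> 'a set \<Rightarrow> 'a \<Rightarrow> bool"
  where "local_minimum_on g A x \<longleftrightarrow>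
    x \<in> A \<and> (\<exists>U. open U \<and> x \<in> U \<and> (\<forall>z\<in>U \<inter> A. g x \<le> g z))"

definition global_solution :: "('a \<Rightarrow> ereal) \<Rightarrow> 'a set \<Rightarrow> 'a set \<Rightarrow> 'a \<Rightarrow> bool"
  where "global_solution f M A x \<longleftrightarrow> x \<in> M \<inter> A \<and> (\<forall>y\<in>M \<inter> A. f x \<le> f y)"

definition optimal_value :: "('a \<Rightarrow> ereal) \<Rightarrow> 'a set \<Rightarrow> 'a set \<Rightarrow> ereal"
  where "optimal_value f M A = (INF x\<in>M \<inter> A. f x)"

definition penalty_function :: "('a \<Rightarrow> ereal) \<Rightarrow> ('a \<Rightarrow> real) \<Rightarrow> real \<Rightarrow> 'a \<Rightarrow> ereal"
  where "penalty_function f \<phi> l x = f x + ereal (l * \<phi> x)"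

definition exact_on ::
    "('a \<Rightarrow> ereal) \<Rightarrow> ('a \<Rightarrow> real) \<Rightarrow> 'a set \<Rightarrow> 'a set \<Rightarrow> 'a set \<Rightarrow> bool"
  where "exact_on f \<phi> M A C \<longleftrightarrow>
    (\<exists>l0\<ge>0. \<forall>l\<ge>l0. \<forall>x\<in>C. optimal_value f M A \<le> penalty_function f \<phi> l x)"

(* Meaningful for locally (in particular, globally) optimal solutions x of the constrained problem. *)
definition exact_at ::
    "('a::topological_space \<Rightarrow> ereal) \<Rightarrow> ('a \<Rightarrow> real) \<Rightarrow> 'a set \<Rightarrow> 'a \<Rightarrow> bool"
  where "exact_at f \<phi> A x \<longleftrightarrow> (\<exists>l0\<ge>0. local_minimum_on (penalty_function f \<phi> l0) A x)"

end

theory Submission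
  imports Defs
begin

text \<open>
  Both directions are local. If the penalty function is exact on the unit ball around a global
  solution, that solution is a local minimum. Conversely, every point \<open>x\<close> of \<open>A\<close> has a neighbourhood
  on which the penalty function is eventually at least \<open>f\<^sup>*\<close>: by exactness if \<open>x\<close> is a global solution,
  by lower semicontinuity of \<open>f\<close> if \<open>f x > f\<^sup>*\<close>, and otherwise because \<open>x \<notin> M\<close>, so that \<open>\<phi>\<close> is bounded
  away from \<open>0\<close> and \<open>f\<close> is bounded below near \<open>x\<close>. The closure of a bounded subset of \<open>A\<close> is compact,
  so finitely many such neighbourhoods suffice.
\<close>

section \<open>Heine-Borel in finite-dimensional normed spaces\<close>

lemma closed_if_cball_Int_compact:
  fixes S :: "'a::real_normed_vector set"
  assumes "\<And>r. compact (cball 0 r \<inter> S)"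
  shows "closed S"
  unfolding closed_sequential_limits
proof (intro allI impI, elim conjE)
  fix u l
  assume u: "\<forall>n. u n \<in> S" and lim: "u \<longlonglongrightarrow> l"
  \<comment> \<open>A convergent sequence stays in one ball, so the closedness of a single
    truncation of \<open>S\<close> captures its limit.\<close>
  have "bounded (range u)"
    using lim convergent_imp_bounded by blast
  then obtain r where "\<And>n. norm (u n) \<le> r"
    unfolding bounded_iff by blast
  with u have "\<And>n. u n \<in> cball 0 r \<inter> S"
    by simp
  moreover have "closed (cball 0 r \<inter> S)"
    using assms compact_imp_closed by blast
  ultimately show "l \<in> S"
    using lim closed_sequentially by blast
qed

text \<open>A new independent vector \<open>b\<close> has positive distance from the span of the
  others, which bounds its coefficient on a ball. The radius stays arbitrary: the induction step
  uses the hypothesis at the radius \<open>r'\<close>, and at all radii to see that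
  \<open>span B\<close> is closed.\<close>

lemma compact_cball_Int_span:
  fixes B :: "'a::real_normed_vector set"
  assumes "finite B"
  shows "compact (cball 0 r \<inter> span B)"
  using assms
proof (induction B arbitrary: r rule: finite_induct)
  case empty
  \<comment> \<open>The intersection is empty exactly when \<open>r\<close> is negative.\<close>
  have "cball 0 r \<inter> span {} = {} \<or> cball 0 r \<inter> span {} = {0::'a}"
    by auto
  then show ?case
    by (metis compact_empty compact_sing)
next
  case (insert b B)
  show ?case
  proof (cases "b \<in> span B")
    case True
    then show ?thesis
      using insert.IH by (simp add: span_redundant)
  next
    case False
    have "closed (span B)"
      using insert.IH by (rule closed_if_cball_Int_compact)
    then obtain d where "d > 0" and "ball b d \<subseteq> - span B"
      using False open_contains_ball[of "- span B"] by auto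
    then have d: "d \<le> dist b s" if "s \<in> span B" for s
      using that by force
    \<comment> \<open>Here \<open>r / d\<close> will bound the coefficient of \<open>b\<close>, and
      \<open>r'\<close> then bounds the remainder in \<open>span B\<close> by the triangle
      inequality. \<open>K\<close> is a sum of two compact sets.\<close>
    define r' where "r' = r + r / d * norm b"
    define K where "K = {x + y |x y. x \<in> (\<lambda>c. c *\<^sub>R b) ` {- (r / d)..r / d} \<and> y \<in> cball 0 r' \<inter> span B}"
    have "compact ((\<lambda>c. c *\<^sub>R b) ` {- (r / d)..r / d})"
      by (intro compact_continuous_image continuous_intros) simp
    then have "compact K"
      unfolding K_def using insert.IH by (rule compact_sums)
    moreover have "K \<subseteq> span (insert b B)"
      using span_mono[OF subset_insertI, of B b]
      by (force simp: K_def intro: span_add span_scale span_base)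
    moreover have "cball 0 r \<inter> span (insert b B) \<subseteq> K"
    proof
      fix x assume "x \<in> cball 0 r \<inter> span (insert b B)"
      then have nx: "norm x \<le> r" and "x \<in> span (insert b B)"
        by auto
      then obtain c where s: "x - c *\<^sub>R b \<in> span B"
        unfolding span_insert by blast
      have "\<bar>c\<bar> * d \<le> norm x"
      proof (cases "c = 0")
        case False
        \<comment> \<open>Dividing by \<open>c\<close> writes \<open>x / c\<close> as
          \<open>b\<close> minus an element of \<open>span B\<close>, so its norm is at least
          \<open>d\<close>.\<close>
        have "- (inverse c *\<^sub>R (x - c *\<^sub>R b)) \<in> span B"
          using s by (intro span_neg span_scale)
        then have "d \<le> norm (b + inverse c *\<^sub>R (x - c *\<^sub>R b))"
          using d by (fastforce simp: dist_norm)
        also have "b + inverse c *\<^sub>R (x - c *\<^sub>R b) = inverse c *\<^sub>R x"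
          using False by (simp add: algebra_simps)
        finally show ?thesis
          using False by (simp add: field_simps)
      qed simp
      with nx have "\<bar>c\<bar> * d \<le> r"
        by linarith
      then have c: "\<bar>c\<bar> \<le> r / d"
        using \<open>d > 0\<close> by (simp add: field_simps)
      have "norm (x - c *\<^sub>R b) \<le> norm x + \<bar>c\<bar> * norm b"
        by (metis norm_scaleR norm_triangle_ineq4)
      also have "\<dots> \<le> r'"
        unfolding r'_def using nx c by (intro add_mono mult_right_mono) auto
      finally have "x - c *\<^sub>R b \<in> cball 0 r' \<inter> span B"
        using s by simp
      moreover have "c *\<^sub>R b \<in> (\<lambda>c. c *\<^sub>R b) ` {- (r / d)..r / d}"
        using c by (intro imageI) auto
      ultimately show "x \<in> K"
        unfolding K_def by (intro CollectI exI[of _ "c *\<^sub>R b"] exI[of _ "x - c *\<^sub>R b"]) simp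
    qed
    \<comment> \<open>\<open>K\<close> may stick out of the ball, but inside the ball it agrees with
      the span.\<close>
    ultimately have "cball 0 r \<inter> span (insert b B) = cball 0 r \<inter> K"
      by blast
    then show ?thesis
      using \<open>compact K\<close> by (simp add: closed_Int_compact)
  qed
qed

lemma compact_if_bounded_closed_finite_dimensional:
  fixes B K :: "'a::real_normed_vector set"
  assumes "finite_dimensional_vector_space (scaleR :: real \<Rightarrow> 'a \<Rightarrow> 'a) B"
    and "bounded K" and "closed K"
  shows "compact K"
proof -
  interpret fd: finite_dimensional_vector_space "scaleR :: real \<Rightarrow> 'a \<Rightarrow> 'a" B
    by (fact assms)
  have "span B = UNIV"
    using fd.span_Basis by (simp add: span_raw_def)
  then have "compact (cball (0::'a) r)" for r
    using compact_cball_Int_span[OF fd.finite_Basis, of r] by simp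
  moreover obtain r where "K \<subseteq> cball 0 r"
    using \<open>bounded K\<close> by (auto simp: bounded_iff subset_iff)
  ultimately show ?thesis
    by (metis assms(3) closed_Int_compact inf.absorb1)
qed

section \<open>Lower semicontinuity and values of the penalty function\<close>

lemma lower_semicontinuous_on_neighbourhood:
  assumes "lower_semicontinuous_on A g" and "x \<in> A" and "y < g x"
  obtains U where "open U" and "x \<in> U" and "\<And>z. z \<in> U \<inter> A \<Longrightarrow> y < g z"
proof -
  have "\<forall>\<^sub>F z in at x within A. y < g z"
    using assms by (auto simp: lower_semicontinuous_on_def)
  then obtain U where "open U" "x \<in> U" "\<forall>z\<in>U. z \<noteq> x \<longrightarrow> z \<in> A \<longrightarrow> y < g z"
    unfolding eventually_at_topological by blast
  \<comment> \<open>The filter omits \<open>x\<close> itself; there the bound is the assumption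
    \<open>y < g x\<close>.\<close>
  with assms(3) that show thesis
    by (metis IntE)
qed

lemma penalty_function_mono:
  assumes "0 \<le> \<phi> x" and "l \<le> l'"
  shows "penalty_function f \<phi> l x \<le> penalty_function f \<phi> l' x"
  unfolding penalty_function_def using assms by (intro add_left_mono) (simp add: mult_right_mono)

lemma optimal_value_eq_global_solution:
  assumes "global_solution f M A x"
  shows "optimal_value f M A = f x"
  unfolding optimal_value_def using assms
  by (intro antisym INF_lower INF_greatest) (auto simp: global_solution_def)

text \<open>A finite subcover leaves finitely many thresholds to dominate. \<open>K\<close> is
  separate from \<open>C\<close> because \<open>C\<close> need not be closed: the hypothesis is also
  needed at limit points of \<open>C\<close>.\<close>

lemma exact_on_if_exact_near_points:
  assumes "compact K" and "C \<subseteq> K"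
    and "\<And>x. x \<in> K \<Longrightarrow> \<exists>U. open U \<and> x \<in> U \<and> exact_on f \<phi> M A (U \<inter> C)"
  shows "exact_on f \<phi> M A C"
proof -
  obtain U where U: "\<And>x. x \<in> K \<Longrightarrow> open (U x) \<and> x \<in> U x \<and> exact_on f \<phi> M A (U x \<inter> C)"
    using assms(3) by metis
  then obtain l where l: "\<And>x. x \<in> K \<Longrightarrow> 0 \<le> l x"
    "\<And>x z l'. x \<in> K \<Longrightarrow> z \<in> U x \<inter> C \<Longrightarrow> l x \<le> l' \<Longrightarrow>
      optimal_value f M A \<le> penalty_function f \<phi> l' z"
    unfolding exact_on_def by metis
  obtain D where D: "D \<subseteq> K" "finite D" "K \<subseteq> (\<Union>x\<in>D. U x)"
    using compactE_image[OF assms(1), of K U] U by blast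
  \<comment> \<open>The thresholds are nonnegative, so their sum dominates each of them, and it
    makes sense for empty \<open>D\<close> too.\<close>
  define l0 where "l0 = (\<Sum>x\<in>D. l x)"
  have le: "l x \<le> l0" if "x \<in> D" for x
    unfolding l0_def using that D l(1) by (intro member_le_sum) auto
  have "optimal_value f M A \<le> penalty_function f \<phi> l' z"
    if "l0 \<le> l'" and z: "z \<in> C" for l' z
  proof -
    obtain x where "x \<in> D" "z \<in> U x"
      using z assms(2) D(3) by blast
    with le[of x] that D(1) show ?thesis
      by (intro l(2)[of x]) auto
  qed
  moreover have "0 \<le> l0"
    unfolding l0_def using D l(1) by (intro sum_nonneg) auto
  ultimately show ?thesis
    unfolding exact_on_def by blast
qed

section \<open>Exactness near a single point\<close>

lemma exact_near_global_solution:
  assumes "\<And>x. 0 \<le> \<phi> x" and "\<phi> x = 0"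
    and "global_solution f M A x" and "exact_at f \<phi> A x"
  shows "\<exists>U. open U \<and> x \<in> U \<and> exact_on f \<phi> M A (U \<inter> A)"
proof -
  obtain l U where "0 \<le> l" and U: "open U" "x \<in> U"
    and min: "\<And>z. z \<in> U \<inter> A \<Longrightarrow> penalty_function f \<phi> l x \<le> penalty_function f \<phi> l z"
    using assms(4) by (auto simp: exact_at_def local_minimum_on_def)
  \<comment> \<open>The local minimum value is the optimal value because the penalty vanishes at
    \<open>x\<close>; monotonicity in the parameter then covers every
    \<open>l' \<ge> l\<close>.\<close>
  have "penalty_function f \<phi> l x = optimal_value f M A"
    using assms(2,3) by (simp add: optimal_value_eq_global_solution penalty_function_def)
  with min have "optimal_value f M A \<le> penalty_function f \<phi> l' z"
    if "l \<le> l'" "z \<in> U \<inter> A" for l' z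
    using that penalty_function_mono[of \<phi>, OF assms(1)] by (metis order_trans)
  with U \<open>0 \<le> l\<close> show ?thesis
    unfolding exact_on_def by blast
qed

lemma exact_near_large_value:
  assumes "\<And>x. 0 \<le> \<phi> x" and "lower_semicontinuous_on A f"
    and "x \<in> A" and "optimal_value f M A < f x"
  shows "\<exists>U. open U \<and> x \<in> U \<and> exact_on f \<phi> M A (U \<inter> A)"
proof -
  obtain U where U: "open U" "x \<in> U" "\<And>z. z \<in> U \<inter> A \<Longrightarrow> optimal_value f M A < f z"
    using lower_semicontinuous_on_neighbourhood[OF assms(2-4)] by blast
  \<comment> \<open>Threshold 0 suffices: the penalty function at parameter 0 is \<open>f\<close>,
    and a larger parameter only increases it.\<close>
  have "optimal_value f M A \<le> penalty_function f \<phi> l z" if "0 \<le> l" "z \<in> U \<inter> A" for l z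
    using U(3)[OF that(2)] penalty_function_mono[of \<phi> z, OF assms(1) that(1), of f]
    by (simp add: penalty_function_def)
  with U(1,2) show ?thesis
    unfolding exact_on_def by blast
qed

lemma exact_near_positive_penalty:
  assumes "\<And>x. 0 \<le> \<phi> x"
    and "lower_semicontinuous_on A f" and "lower_semicontinuous_on A \<phi>"
    and "x \<in> A" and "0 < \<phi> x" and "f x \<noteq> -\<infinity>" and "optimal_value f M A \<noteq> \<infinity>"
  shows "\<exists>U. open U \<and> x \<in> U \<and> exact_on f \<phi> M A (U \<inter> A)"
proof -
  obtain v where v: "optimal_value f M A \<le> ereal v"
    using assms(7) by (cases "optimal_value f M A") auto
  have "- \<infinity> < f x"
    using assms(6) by simp
  \<comment> \<open>A real lower bound exists even when \<open>f x\<close> is infinite, so the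
    threshold below can be computed in the reals.\<close>
  then obtain m where "ereal m < f x"
    using ereal_dense2 by blast
  then obtain U where U: "open U" "x \<in> U" "\<And>z. z \<in> U \<inter> A \<Longrightarrow> ereal m < f z"
    using lower_semicontinuous_on_neighbourhood[OF assms(2,4)] by blast
  define e where "e = \<phi> x / 2"
  have e: "0 < e" "e < \<phi> x"
    using assms(5) by (auto simp: e_def)
  then obtain V where V: "open V" "x \<in> V" "\<And>z. z \<in> V \<inter> A \<Longrightarrow> e < \<phi> z"
    using lower_semicontinuous_on_neighbourhood[OF assms(3,4)] by blast
  \<comment> \<open>Chosen so that \<open>m + l0 * e \<ge> v\<close>; the maximum with 0 handles
    \<open>v < m\<close>.\<close>
  define l0 where "l0 = max 0 ((v - m) / e)"
  have "optimal_value f M A \<le> penalty_function f \<phi> l z"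
    if "l0 \<le> l" "z \<in> (U \<inter> V) \<inter> A" for l z
  proof -
    have "v - m \<le> l0 * e"
      using e by (simp add: l0_def max_def field_simps)
    also have "\<dots> \<le> l * \<phi> z"
      using that V(3)[of z] e by (intro mult_mono) (auto simp: l0_def)
    finally have "ereal v \<le> ereal m + ereal (l * \<phi> z)"
      by simp
    also have "\<dots> \<le> penalty_function f \<phi> l z"
      unfolding penalty_function_def using U(3)[of z] that by (intro add_right_mono) auto
    finally show ?thesis
      using v by (rule order_trans[rotated])
  qed
  moreover have "0 \<le> l0"
    by (simp add: l0_def)
  ultimately have "exact_on f \<phi> M A ((U \<inter> V) \<inter> A)"
    unfolding exact_on_def by blast
  with U V show ?thesis
    by (metis IntI open_Int)
qed

section \<open>The equivalence\<close>

lemma exact_at_if_exact_on_ball: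
  fixes x :: "'a::metric_space"
  assumes "\<phi> x = 0" and "global_solution f M A x" and "exact_on f \<phi> M A (ball x 1 \<inter> A)"
  shows "exact_at f \<phi> A x"
proof -
  obtain l where "0 \<le> l" and l: "\<forall>z\<in>ball x 1 \<inter> A. optimal_value f M A \<le> penalty_function f \<phi> l z"
    using assms(3) by (auto simp: exact_on_def)
  moreover have "penalty_function f \<phi> l x = optimal_value f M A"
    using assms(1,2) by (simp add: optimal_value_eq_global_solution penalty_function_def)
  moreover have "x \<in> A"
    using assms(2) by (simp add: global_solution_def)
  ultimately have "local_minimum_on (penalty_function f \<phi> l) A x"
    unfolding local_minimum_on_def by (intro conjI exI[of _ "ball x 1"]) auto
  with \<open>0 \<le> l\<close> show ?thesis
    unfolding exact_at_def by blast
qed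

theorem theorem3p18:
  fixes f :: "'a::real_normed_vector \<Rightarrow> ereal"
    and \<phi> :: "'a \<Rightarrow> real"
    and M A :: "'a set"
  assumes "\<exists>B :: 'a set. finite_dimensional_vector_space (scaleR :: real \<Rightarrow> 'a \<Rightarrow> 'a) B"
    and "M \<noteq> {}" and "A \<noteq> {}"
    and "\<forall>x. f x \<noteq> -\<infinity>"
    and "\<forall>x. 0 \<le> \<phi> x"
    and "M = {x. \<phi> x = 0}"
    and "\<exists>x\<in>M \<inter> A. f x < \<infinity>"
    and "\<exists>x. global_solution f M A x"
    and "lower_semicontinuous_on A f"
    and "lower_semicontinuous_on A \<phi>"
    and "closed A"
  shows "(\<forall>C. C \<noteq> {} \<and> C \<subseteq> A \<and> bounded C \<longrightarrow> exact_on f \<phi> M A C) \<longleftrightarrow>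
         (\<forall>x. global_solution f M A x \<longrightarrow> exact_at f \<phi> A x)"
proof (intro iffI allI impI)
  fix x
  assume exact: "\<forall>C. C \<noteq> {} \<and> C \<subseteq> A \<and> bounded C \<longrightarrow> exact_on f \<phi> M A C"
    and sol: "global_solution f M A x"
  have "x \<in> A" "\<phi> x = 0"
    using sol assms(6) by (auto simp: global_solution_def)
  have "x \<in> ball x 1 \<inter> A" "bounded (ball x 1 \<inter> A)"
    using \<open>x \<in> A\<close> by (simp_all add: bounded_Int)
  then have "ball x 1 \<inter> A \<noteq> {} \<and> ball x 1 \<inter> A \<subseteq> A \<and> bounded (ball x 1 \<inter> A)"
    by blast
  then have "exact_on f \<phi> M A (ball x 1 \<inter> A)"
    by (rule exact[rule_format])
  with \<open>\<phi> x = 0\<close> sol show "exact_at f \<phi> A x"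
    by (rule exact_at_if_exact_on_ball)
next
  fix C
  assume exact: "\<forall>x. global_solution f M A x \<longrightarrow> exact_at f \<phi> A x"
    and C: "C \<noteq> {} \<and> C \<subseteq> A \<and> bounded C"
  have "optimal_value f M A \<noteq> \<infinity>"
    using assms(7) INF_lower[of _ "M \<inter> A" f] unfolding optimal_value_def
    by (metis ereal_infty_less_eq(1) less_irrefl)
  have near: "\<exists>U. open U \<and> x \<in> U \<and> exact_on f \<phi> M A (U \<inter> A)" if "x \<in> A" for x
  proof (cases "optimal_value f M A < f x")
    case True
    then show ?thesis
      using assms(5,9) that by (intro exact_near_large_value) simp_all
  next
    case le: False
    show ?thesis
    proof (cases "\<phi> x = 0")
      case True
      \<comment> \<open>Here \<open>x\<close> is feasible and \<open>f x\<close> does not exceed the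
        infimum, so \<open>x\<close> attains it.\<close>
      have "f x \<le> f y" if "y \<in> M \<inter> A" for y
        using le INF_lower[OF that, of f] by (simp add: optimal_value_def)
      with True \<open>x \<in> A\<close> assms(6) have "global_solution f M A x"
        by (simp add: global_solution_def)
      with True exact assms(5) show ?thesis
        by (intro exact_near_global_solution) simp_all
    next
      case False
      then have "0 < \<phi> x"
        using assms(5) by (simp add: order_less_le)
      with that show ?thesis
        using assms(4,5,9,10) \<open>optimal_value f M A \<noteq> \<infinity>\<close>
        by (intro exact_near_positive_penalty) simp_all
    qed
  qed
  \<comment> \<open>Closedness of \<open>A\<close> keeps the limit points of \<open>C\<close> where
    local exactness is known.\<close>
  have "closure C \<subseteq> A"
    using C assms(11) by (simp add: closure_minimal)
  moreover have "\<exists>U. open U \<and> x \<in> U \<and> exact_on f \<phi> M A (U \<inter> C)"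
    if x: "x \<in> A" for x
  proof -
    obtain U where U: "open U" "x \<in> U" "exact_on f \<phi> M A (U \<inter> A)"
      using near[OF x] by blast
    moreover have "U \<inter> C \<subseteq> U \<inter> A"
      using C by blast
    ultimately show ?thesis
      unfolding exact_on_def by (metis subsetD)
  qed
  moreover have "compact (closure C)"
    using assms(1) C compact_if_bounded_closed_finite_dimensional
    by (metis bounded_closure closed_closure)
  ultimately show "exact_on f \<phi> M A C"
    by (intro exact_on_if_exact_near_points[OF _ closure_subset]) blast+
qed

end
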